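(* Twists do not change the Lyapunov exponents: let $D$ be a positive non-square discriminant, $\mathrm{SL}(L_D)$ one of the Veech groups of discriminant $D$ with Teichmüller curve $C=\mathbb{H}/\mathrm{SL}(L_D)\to X_D$. Then for every $M\in\mathrm{GL}_2^+(K)$ the Lyapunov exponents of the twisted Teichmüller curve $C_M\to X_D$ are equal to the Lyapunov exponents of $C\to X_D$.
   Context: $D>0$ is a non-square integer with $D\equiv 0,1 \bmod 4$; $K=\mathbb{Q}(\sqrt D)$, $\sigma$ its nontrivial Galois automorphism (applied entrywise to matrices); $\mathcal{O}_D=\mathbb{Z}\oplus\mathbb{Z}w$, $w=\frac{1+\sqrt D}{2}$ if $D\equiv1\bmod 4$, $w=\frac{\sqrt D}{2}$ if $D\equiv 0\bmod 4$. $\mathrm{GL}_2^+(K)$: matrices in $\mathrm{GL}_2(K)$ with totally positive determinant. $\mathbb{H},\mathbb{H}^-$: upper/lower half planes; $X_D=\mathbb{H}\times\mathbb{H}^-/\mathrm{SL}_2(\mathcal{O}_D)$ with action $(z_1,z_2)\mapsto(Az_1,A^\sigma z_2)$; it parametrizes principally polarized Abelian surfaces $A$ with a choice of real multiplication by $\mathcal{O}_D$. Veech groups: for $a,b>1$ let $P(a,b)$ be the L-shaped polygon with vertices $(0,0),(b,0),(b,a),(b-1,a),(b-1,1),(0,1)$; gluing opposite parallel sides by translations gives a genus 2 translation surface. Its Veech group is the group of derivatives in $\mathrm{SL}_2(\mathbb{R})$ of its orientation-preserving affine homeomorphisms. $\mathrm{SL}(L_D^1)$ is the Veech group of $P(w,w)$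 if $D\equiv 1\bmod 4$ and of $P(w,w+1)$ if $D\equiv0\bmod 4$; if $D\equiv1\bmod 8$, $\mathrm{SL}(L_D^0)$ is the Veech group of $P(w+1,w-1)$. These are lattices contained in $\mathrm{SL}_2(\mathcal{O}_D)$; $\mathrm{SL}(L_D)$ denotes any one of them. Graph (McMullen): sending a Riemann surface on $C$ to its Jacobian with real multiplication by $\mathcal{O}_D$ embeds $C$ into $X_D$; this map lifts to $z\mapsto(z,\varphi(z))\in\mathbb{H}\times\mathbb{H}^-$, with $\varphi$ holomorphic and not Möbius, and $\mathrm{SL}(L_D)=\{A\in\mathrm{SL}_2(\mathcal{O}_D): \varphi(Az)=A^\sigma\varphi(z)\ \forall z\in\mathbb{H}\}$. Twists: for $M\in\mathrm{GL}_2^+(K)$, $\mathrm{SL}_M(L_D)=\{A\in\mathrm{SL}_2(\mathcal{O}_D): B=M^{-1}AM\text{ satisfies }\varphi(Bz)=B^\sigma\varphi(z)\ \forall z\}$ and the twisted Teichmüller curve is $C_M=\mathbb{H}/\mathrm{SL}_M(L_D)\to X_D$, induced by $z\mapsto(Mz,M^\sigma\varphi(z))$; it has finite hyperbolic area. Lyapunov exponents of a finite-area curve $\mathbb{H}/\Gamma\to X_D$ (here $\Gamma=\mathrm{SL}(L_D)$ or $\Gamma=\mathrm{SL}_M(L_D)$): consider the rank 4 local system with fibre $H^1(A,\mathbb{R})$ over the point of $X_D$ corresponding to the Abelian surface $A$, pull it back to the unit tangent bundle $T^1\mathbb{H}/\Gamma$, equip it with the Hodge norm, and lift the geodesic flow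 (for the Poincaré metric of curvature $-4$, i.e. right multiplication by $\mathrm{diag}(e^t,e^{-t})$ on $\mathrm{PSL}_2(\mathbb{R})/\Gamma$-type coordinates) to it by parallel transport. This is a linear symplectic cocycle over an ergodic flow (for the normalized invariant Liouville/Haar measure), and its Lyapunov exponents are those given by Oseledets' theorem, i.e. the values $\lim_{t\to\infty}\frac1t\log\|A^t(x)v\|$; for $C$ this cocycle is the Kontsevich–Zorich cocycle. *)

theory Defs
  imports "HOL-Analysis.Analysis" "HOL-Library.Multiset"
begin

section \<open>The real quadratic order and its matrices\<close>

text \<open>The field \<open>K = \<rat>(\<surd>D)\<close> is regarded as a subset of the reals through the embedding with
  \<open>\<surd>D > 0\<close>; the second embedding is \<open>galois D\<close>, which is only meaningful on \<open>K\<close> and for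
  non-square \<open>D\<close>.\<close>

definition quad_field :: "int \<Rightarrow> real set" where
  "quad_field D = {p + q * sqrt (of_int D) | p q. p \<in> \<rat> \<and> q \<in> \<rat>}"

definition galois :: "int \<Rightarrow> real \<Rightarrow> real" where
  "galois D x = (THE y. \<exists>p\<in>\<rat>. \<exists>q\<in>\<rat>. x = p + q * sqrt (of_int D) \<and> y = p - q * sqrt (of_int D))"

definition w_gen :: "int \<Rightarrow> real" where
  "w_gen D = (if D mod 4 = 1 then (1 + sqrt (of_int D)) / 2 else sqrt (of_int D) / 2)"

definition quad_order :: "int \<Rightarrow> real set" where
  "quad_order D = {of_int m + of_int n * w_gen D | m n. True}"

definition galois_mat :: "int \<Rightarrow> real^2^2 \<Rightarrow> real^2^2" where
  "galois_mat D A = (\<chi> i j. galois D (A $ i $ j))"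

definition SL2_order :: "int \<Rightarrow> (real^2^2) set" where
  "SL2_order D = {A. (\<forall>i j. A $ i $ j \<in> quad_order D) \<and> det A = 1}"

definition GL2_plus :: "int \<Rightarrow> (real^2^2) set" where
  "GL2_plus D = {M. (\<forall>i j. M $ i $ j \<in> quad_field D) \<and> det M > 0 \<and> galois D (det M) > 0}"

definition upper_half_plane :: "complex set" where
  "upper_half_plane = {z. Im z > 0}"

definition lower_half_plane :: "complex set" where
  "lower_half_plane = {z. Im z < 0}"

definition mobius :: "real^2^2 \<Rightarrow> complex \<Rightarrow> complex" where
  "mobius A z = (of_real (A$1$1) * z + of_real (A$1$2)) / (of_real (A$2$1) * z + of_real (A$2$2))"

definition is_mobius_on :: "complex set \<Rightarrow> (complex \<Rightarrow> complex) \<Rightarrow> bool" where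
  "is_mobius_on S f \<longleftrightarrow> (\<exists>a b c d. a * d - b * c \<noteq> 0 \<and>
     (\<forall>z\<in>S. c * z + d \<noteq> 0 \<and> f z = (a * z + b) / (c * z + d)))"

section \<open>Veech groups of L-shaped translation surfaces\<close>

text \<open>For \<open>a, b > 1\<close> this is the closed polygon with vertices
  \<open>(0,0), (b,0), (b,a), (b-1,a), (b-1,1), (0,1)\<close>.\<close>

definition L_polygon :: "real \<Rightarrow> real \<Rightarrow> (real^2) set" where
  "L_polygon a b = {p. 0 \<le> p$1 \<and> p$1 \<le> b \<and> 0 \<le> p$2 \<and> p$2 \<le> 1} \<union>
                   {p. b - 1 \<le> p$1 \<and> p$1 \<le> b \<and> 0 \<le> p$2 \<and> p$2 \<le> a}"

definition L_vertices :: "real \<Rightarrow> real \<Rightarrow> (real^2) set" where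
  "L_vertices a b = {vector [0,0], vector [b,0], vector [b,a], vector [b-1,a],
                     vector [b-1,1], vector [0,1]}"

text \<open>The right side of length \<open>a\<close> and the bottom side of length \<open>b\<close> are each glued in two pieces
  to the two sides opposite to them.\<close>

definition L_sides :: "real \<Rightarrow> real \<Rightarrow> ((real^2) \<times> (real^2)) set" where
  "L_sides a b =
     {(vector [0,y], vector [b,y]) | y. 0 \<le> y \<and> y \<le> 1} \<union>
     {(vector [b-1,y], vector [b,y]) | y. 1 \<le> y \<and> y \<le> a} \<union>
     {(vector [x,0], vector [x,1]) | x. 0 \<le> x \<and> x \<le> b - 1} \<union>
     {(vector [x,0], vector [x,a]) | x. b - 1 \<le> x \<and> x \<le> b}"

definition L_glued :: "real \<Rightarrow> real \<Rightarrow> ((real^2) \<times> (real^2)) set" where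
  "L_glued a b = {(p, q). p \<in> L_polygon a b \<and> q \<in> L_polygon a b \<and>
                          (p, q) \<in> (L_sides a b \<union> (L_sides a b)\<inverse>)\<^sup>*}"

definition L_surface :: "real \<Rightarrow> real \<Rightarrow> (real^2) set set" where
  "L_surface a b = L_polygon a b // L_glued a b"

definition L_topology :: "real \<Rightarrow> real \<Rightarrow> (real^2) set topology" where
  "L_topology a b = topology (\<lambda>U. U \<subseteq> L_surface a b \<and> openin (top_of_set (L_polygon a b)) (\<Union>U))"

lemma equiv_L_glued: "equiv (L_polygon a b) (L_glued a b)"
proof (rule equivI)
  show "L_glued a b \<subseteq> L_polygon a b \<times> L_polygon a b"
    by (auto simp: L_glued_def)
  show "refl_on (L_polygon a b) (L_glued a b)"
    by (auto simp: refl_on_def L_glued_def)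
  have "sym ((L_sides a b \<union> (L_sides a b)\<inverse>)\<^sup>*)"
    by (intro sym_rtrancl sym_Un_converse)
  then show "sym (L_glued a b)"
    by (auto simp: sym_def L_glued_def)
  show "trans (L_glued a b)"
    by (auto simp: trans_def L_glued_def intro: rtrancl_trans)
qed

lemma openin_L_topology:
  "openin (L_topology a b) U \<longleftrightarrow>
     U \<subseteq> L_surface a b \<and> openin (top_of_set (L_polygon a b)) (\<Union>U)"
proof -
  have "istopology (\<lambda>U. U \<subseteq> L_surface a b \<and> openin (top_of_set (L_polygon a b)) (\<Union>U))"
    unfolding istopology_def
  proof (intro conjI allI impI)
    fix S T :: "(real^2) set set"
    assume S: "S \<subseteq> L_surface a b \<and> openin (top_of_set (L_polygon a b)) (\<Union>S)"
      and T: "T \<subseteq> L_surface a b \<and> openin (top_of_set (L_polygon a b)) (\<Union>T)"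
    have "\<Union>(S \<inter> T) = \<Union>S \<inter> \<Union>T"
    proof (intro equalityI subsetI)
      fix x assume "x \<in> \<Union>S \<inter> \<Union>T"
      then obtain s t where st: "s \<in> S" "x \<in> s" "t \<in> T" "x \<in> t" by auto
      then have "s = t"
        using quotient_disj[OF equiv_L_glued, of s a b t] S T unfolding L_surface_def by blast
      then show "x \<in> \<Union>(S \<inter> T)" using st by auto
    qed auto
    then show "openin (top_of_set (L_polygon a b)) (\<Union>(S \<inter> T))"
      using S T by (metis openin_Int)
    show "S \<inter> T \<subseteq> L_surface a b" using S by auto
  next
    fix \<K> :: "(real^2) set set set"
    assume K: "\<forall>K\<in>\<K>. K \<subseteq> L_surface a b \<and> openin (top_of_set (L_polygon a b)) (\<Union>K)"
    then show "\<Union>\<K> \<subseteq> L_surface a b" by auto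
    have "\<Union>(\<Union>\<K>) = \<Union>((\<lambda>K. \<Union>K) ` \<K>)" by auto
    then show "openin (top_of_set (L_polygon a b)) (\<Union>(\<Union>\<K>))"
      using K by (metis (no_types, lifting) imageE openin_Union)
  qed
  then show ?thesis unfolding L_topology_def by simp
qed

text \<open>All vertices, together with \<open>(b-1,0)\<close> and \<open>(b,1)\<close>, are identified to one cone point of
  angle \<open>6\<pi>\<close>; every other point of the surface has angle \<open>2\<pi>\<close>.\<close>

definition L_singular :: "real \<Rightarrow> real \<Rightarrow> (real^2) set set" where
  "L_singular a b = {p \<in> L_surface a b. p \<inter> L_vertices a b \<noteq> {}}"

text \<open>For a non-singular point \<open>p\<close> and all sufficiently small \<open>h\<close>, some representative of \<open>p\<close> can be
  translated by \<open>h\<close> inside the polygon, and the class obtained does not depend on the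
  representative. The map \<open>h \<mapsto> L_shift a b p h\<close> is the inverse of a translation chart centred at
  \<open>p\<close>. (For a cone point or for large \<open>h\<close> the class is not unique or does not exist.)\<close>

definition L_shift :: "real \<Rightarrow> real \<Rightarrow> (real^2) set \<Rightarrow> real^2 \<Rightarrow> (real^2) set" where
  "L_shift a b p h = (THE s. s \<in> L_surface a b \<and> (\<exists>q\<in>p. q + h \<in> s))"

definition L_affine_with ::
    "real \<Rightarrow> real \<Rightarrow> ((real^2) set \<Rightarrow> (real^2) set) \<Rightarrow> real^2^2 \<Rightarrow> bool" where
  "L_affine_with a b f A \<longleftrightarrow>
     homeomorphic_map (L_topology a b) (L_topology a b) f \<and>
     f ` L_singular a b = L_singular a b \<and>
     (\<forall>p \<in> L_surface a b - L_singular a b. \<exists>\<epsilon>>0. \<forall>h. norm h < \<epsilon> \<longrightarrow>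
        f (L_shift a b p h) = L_shift a b (f p) (A *v h))"

definition veech_group :: "real \<Rightarrow> real \<Rightarrow> (real^2^2) set" where
  "veech_group a b = {A. det A = 1 \<and> (\<exists>f. L_affine_with a b f A)}"

text \<open>The groups \<open>SL(L\<^sub>D\<^sup>1)\<close> and, if \<open>D \<equiv> 1 mod 8\<close>, also \<open>SL(L\<^sub>D\<^sup>0)\<close>.\<close>

definition veech_groups_of_disc :: "int \<Rightarrow> (real^2^2) set set" where
  "veech_groups_of_disc D =
     {if D mod 4 = 1 then veech_group (w_gen D) (w_gen D) else veech_group (w_gen D) (w_gen D + 1)}
     \<union> (if D mod 8 = 1 then {veech_group (w_gen D + 1) (w_gen D - 1)} else {})"

section \<open>Teichmueller curves in the Hilbert modular surface and their twists\<close>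

definition commutes_with_graph ::
    "int \<Rightarrow> (complex \<Rightarrow> complex) \<Rightarrow> real^2^2 \<Rightarrow> bool" where
  "commutes_with_graph D \<phi> A \<longleftrightarrow>
     (\<forall>z\<in>upper_half_plane. \<phi> (mobius A z) = mobius (galois_mat D A) (\<phi> z))"

text \<open>\<open>z \<mapsto> (z, \<phi> z)\<close> is a lift of the curve \<open>\<H>/\<Gamma> \<rightarrow> X\<^sub>D\<close>, where \<open>X\<^sub>D\<close> is the quotient of
  \<open>\<H> \<times> \<H>\<^sup>-\<close> by \<open>SL\<^sub>2(\<O>\<^sub>D)\<close>.\<close>

definition teichmueller_graph ::
    "int \<Rightarrow> (real^2^2) set \<Rightarrow> (complex \<Rightarrow> complex) \<Rightarrow> bool" where
  "teichmueller_graph D \<Gamma> \<phi> \<longleftrightarrow>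
     \<phi> holomorphic_on upper_half_plane \<and>
     \<phi> ` upper_half_plane \<subseteq> lower_half_plane \<and>
     \<not> is_mobius_on upper_half_plane \<phi> \<and>
     \<Gamma> = {A \<in> SL2_order D. commutes_with_graph D \<phi> A}"

definition graph_map :: "(complex \<Rightarrow> complex) \<Rightarrow> complex \<Rightarrow> complex \<times> complex" where
  "graph_map \<phi> z = (z, \<phi> z)"

definition twisted_group ::
    "int \<Rightarrow> (complex \<Rightarrow> complex) \<Rightarrow> real^2^2 \<Rightarrow> (real^2^2) set" where
  "twisted_group D \<phi> M = {A \<in> SL2_order D. commutes_with_graph D \<phi> (matrix_inv M ** A ** M)}"

text \<open>The lift \<open>z \<mapsto> (M z, M\<^sup>\<sigma> \<phi>(z))\<close> intertwines \<open>M\<inverse> A M\<close> with \<open>A\<close> for \<open>A\<close> in the twisted group.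
  Since the twisted group itself acts on \<open>\<H>\<close> by Moebius transformations, the lift is written
  in the coordinate \<open>\<zeta> = M z\<close>.\<close>

definition twisted_map ::
    "int \<Rightarrow> (complex \<Rightarrow> complex) \<Rightarrow> real^2^2 \<Rightarrow> complex \<Rightarrow> complex \<times> complex" where
  "twisted_map D \<phi> M \<zeta> =
     (let z = mobius (matrix_inv M) \<zeta> in (mobius M z, mobius (galois_mat D M) (\<phi> z)))"

section \<open>Abelian surfaces with real multiplication and the Hodge norm\<close>

text \<open>The point \<open>\<tau> = (z\<^sub>1, z\<^sub>2)\<close> of \<open>\<H> \<times> \<H>\<^sup>-\<close> corresponds to the Abelian surface
  \<open>A\<^sub>\<tau> = \<complex>\<^sup>2 / \<Lambda>\<^sub>\<tau>\<close>, where \<open>\<Lambda>\<^sub>\<tau>\<close> is the image of \<open>\<O>\<^sub>D \<times> \<O>\<^sub>D\<close> under \<open>period_map D \<tau>\<close>. This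
  identifies \<open>H\<^sub>1(A\<^sub>\<tau>, \<int>)\<close> with \<open>\<O>\<^sub>D \<times> \<O>\<^sub>D\<close>, on which the principal polarization is \<open>polarization D\<close>.
  It is positive because \<open>\<surd>D\<close> is positive in the first embedding and negative in the second,
  and \<open>z\<^sub>1\<close>, \<open>z\<^sub>2\<close> lie in opposite half planes. A matrix with rows \<open>(a, b)\<close>, \<open>(c, d)\<close> in
  \<open>SL\<^sub>2(\<O>\<^sub>D)\<close> identifies \<open>A\<^sub>\<tau>\<close> with the surface at the image of \<open>\<tau>\<close> by division by
  \<open>(c z\<^sub>1 + d, c\<^sup>\<sigma> z\<^sub>2 + d\<^sup>\<sigma>)\<close>.\<close>

definition period_map :: "int \<Rightarrow> complex \<times> complex \<Rightarrow> real \<times> real \<Rightarrow> complex \<times> complex" where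
  "period_map D \<tau> l =
     (of_real (fst l) + of_real (snd l) * fst \<tau>,
      of_real (galois D (fst l)) + of_real (galois D (snd l)) * snd \<tau>)"

definition polarization :: "int \<Rightarrow> real \<times> real \<Rightarrow> real \<times> real \<Rightarrow> real" where
  "polarization D l m =
     (let u = (fst l * snd m - fst m * snd l) / sqrt (of_int D) in u + galois D u)"

text \<open>A symplectic basis \<open>a\<^sub>1, a\<^sub>2, b\<^sub>1, b\<^sub>2\<close> of \<open>\<O>\<^sub>D \<times> \<O>\<^sub>D\<close>, see the lemma
  \<open>polarization_cycles\<close> below.\<close>

definition a_cycle :: "int \<Rightarrow> (real \<times> real)^2" where
  "a_cycle D = vector [(1, 0), (w_gen D, 0)]"

definition b_cycle :: "int \<Rightarrow> (real \<times> real)^2" where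
  "b_cycle D = vector [(0, - galois D (w_gen D)), (0, 1)]"

lemma sqrt_disc_irrational:
  fixes D :: int
  assumes "D > 0" and "\<nexists>n::int. D = n\<^sup>2"
  shows "sqrt (of_int D) \<notin> \<rat>"
proof
  assume "sqrt (real_of_int D) \<in> \<rat>"
  then obtain m n :: int where n: "n > 0" and cop: "coprime m n"
      and e: "sqrt (real_of_int D) = of_int m / of_int n"
    by (metis Rats_cases' divide_real_def)
  have "(sqrt (real_of_int D))\<^sup>2 = (of_int m / of_int n)\<^sup>2" using e by simp
  then have "real_of_int D * (of_int n)\<^sup>2 = (of_int m)\<^sup>2"
    using assms(1) n by (simp add: field_simps power2_eq_square)
  then have eq: "D * n\<^sup>2 = m\<^sup>2"
    by (metis of_int_eq_iff of_int_mult of_int_power)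
  then have "n\<^sup>2 dvd m\<^sup>2" by (metis dvd_triv_right)
  then have "n dvd m" by simp
  then have "is_unit n" using cop coprime_absorb_right by blast
  then have "n = 1" using n by simp
  then show False using eq assms(2) by auto
qed

lemma galois_eq:
  fixes D :: int
  assumes D: "D > 0" "\<nexists>n::int. D = n\<^sup>2" and "p \<in> \<rat>" "q \<in> \<rat>"
    and x: "x = p + q * sqrt (of_int D)"
  shows "galois D x = p - q * sqrt (of_int D)"
  unfolding galois_def
proof (rule the_equality)
  show "\<exists>p'\<in>\<rat>. \<exists>q'\<in>\<rat>. x = p' + q' * sqrt (of_int D) \<and>
          p - q * sqrt (of_int D) = p' - q' * sqrt (of_int D)"
    using assms by blast
next
  fix y assume "\<exists>p'\<in>\<rat>. \<exists>q'\<in>\<rat>. x = p' + q' * sqrt (of_int D) \<and> y = p' - q' * sqrt (of_int D)"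
  then obtain p' q' where pq: "p' \<in> \<rat>" "q' \<in> \<rat>" "x = p' + q' * sqrt (of_int D)"
    and y: "y = p' - q' * sqrt (of_int D)" by blast
  have "q = q'"
  proof (rule ccontr)
    assume "q \<noteq> q'"
    then have "sqrt (of_int D) = (p' - p) / (q - q')" using pq x by (simp add: field_simps)
    moreover have "(p' - p) / (q - q') \<in> \<rat>" using pq assms by simp
    ultimately show False using sqrt_disc_irrational[OF D] by simp
  qed
  then show "y = p - q * sqrt (of_int D)" using pq x y by simp
qed

lemma polarization_cycles:
  fixes D :: int
  assumes D: "D > 0" "\<nexists>n::int. D = n\<^sup>2"
  shows "polarization D (a_cycle D $ i) (b_cycle D $ j) = (if i = j then 1 else 0)"
    and "polarization D (a_cycle D $ i) (a_cycle D $ j) = 0"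
    and "polarization D (b_cycle D $ i) (b_cycle D $ j) = 0"
proof -
  define s where "s = sqrt (real_of_int D)"
  have s: "s > 0" "s * s = of_int D" using D by (auto simp: s_def)
  have 0: "galois D 0 = 0" using galois_eq[OF D, of 0 0 0] by simp
  have w: "galois D (w_gen D) = (if D mod 4 = 1 then (1 - s) / 2 else - s / 2)"
    using galois_eq[OF D, of "1/2" "1/2" "w_gen D"] galois_eq[OF D, of 0 "1/2" "w_gen D"]
    by (auto simp: w_gen_def s_def field_simps)
  have inv_s: "s / of_int D = 1 / s"
    using s by (metis nonzero_divide_mult_cancel_left less_irrefl)
  have gs: "galois D ((p + q * s) / s) = q - p / s" if "p \<in> \<rat>" "q \<in> \<rat>" for p q
  proof -
    have "(p + q * s) / s = q + p * (1 / s)" using s by (simp add: field_simps)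
    also have "\<dots> = q + p / of_int D * s" unfolding inv_s[symmetric] by simp
    finally have "galois D ((p + q * s) / s) = q - p / of_int D * s"
      using galois_eq[OF D, of q "p / of_int D"] that unfolding s_def by simp
    also have "p / of_int D * s = p * (1 / s)" unfolding inv_s[symmetric] by simp
    finally show ?thesis by simp
  qed
  have 1: "galois D (1 / s) = - 1 / s"
    using gs[of 1 0] by simp
  have w_s: "w_gen D = (if D mod 4 = 1 then 1/2 else 0) + 1/2 * s"
    by (auto simp: w_gen_def s_def field_simps)
  have w_s': "galois D (w_gen D) = (if D mod 4 = 1 then 1/2 else 0) - 1/2 * s"
    unfolding w by (auto simp: field_simps)
  have 2: "galois D (w_gen D / s) = galois D (w_gen D) / (- s)"
    using gs[of "if D mod 4 = 1 then 1/2 else 0" "1/2"] s(1) unfolding w_s' unfolding w_s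
    by (auto simp: field_simps)
  have 3: "galois D (- galois D (w_gen D) / s) = w_gen D / s"
  proof -
    have eq: "- galois D (w_gen D) = (if D mod 4 = 1 then -1/2 else 0) + 1/2 * s"
      unfolding w_s' by auto
    have "galois D (- galois D (w_gen D) / s) = 1/2 - (if D mod 4 = 1 then -1/2 else 0) / s"
      unfolding eq by (rule gs) auto
    then show ?thesis
      using s(1) unfolding w_s by (auto simp: field_simps)
  qed
  have "w_gen D * galois D (w_gen D) = (if D mod 4 = 1 then (1 - of_int D) / 4 else - of_int D / 4)"
    using s(2) unfolding w_s' unfolding w_s by (auto simp: field_simps)
  then have 4: "w_gen D * galois D (w_gen D) \<in> \<rat>"
    by auto
  have 5: "galois D (- (w_gen D * galois D (w_gen D)) / s) = w_gen D * galois D (w_gen D) / s"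
    using gs[of "- (w_gen D * galois D (w_gen D))" 0] 4 by simp
  have 6: "w_gen D - galois D (w_gen D) = s"
    using w by (auto simp: w_gen_def s_def[symmetric] field_simps)
  show "polarization D (a_cycle D $ i) (a_cycle D $ j) = 0"
    and "polarization D (b_cycle D $ i) (b_cycle D $ j) = 0"
    using exhaust_2[of i] exhaust_2[of j] 0
    by (auto simp: polarization_def a_cycle_def b_cycle_def)
  show "polarization D (a_cycle D $ i) (b_cycle D $ j) = (if i = j then 1 else 0)"
    using exhaust_2[of i] exhaust_2[of j] 1 2 3 5 6 s
    by (auto simp: polarization_def a_cycle_def b_cycle_def Let_def s_def[symmetric] field_simps)
qed

text \<open>A class in \<open>H\<^sup>1(A\<^sub>\<tau>, \<real>) = Hom(H\<^sub>1(A\<^sub>\<tau>, \<int>), \<real>)\<close> is represented by its periods along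
  \<open>a\<^sub>1, a\<^sub>2\<close> (first component) and \<open>b\<^sub>1, b\<^sub>2\<close> (second component).\<close>

type_synonym coh1 = "(real^2) \<times> (real^2)"

definition form_period ::
    "int \<Rightarrow> complex \<times> complex \<Rightarrow> complex \<times> complex \<Rightarrow> real \<times> real \<Rightarrow> complex" where
  "form_period D \<tau> c l = fst c * fst (period_map D \<tau> l) + snd c * snd (period_map D \<tau> l)"

text \<open>The unique holomorphic one-form \<open>\<omega> = c\<^sub>1 du\<^sub>1 + c\<^sub>2 du\<^sub>2\<close> on \<open>A\<^sub>\<tau>\<close> whose real part
  represents the given class.\<close>

definition holomorphic_rep :: "int \<Rightarrow> complex \<times> complex \<Rightarrow> coh1 \<Rightarrow> complex \<times> complex" where
  "holomorphic_rep D \<tau> \<alpha> = (THE c. \<forall>j.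
     Re (form_period D \<tau> c (a_cycle D $ j)) = fst \<alpha> $ j \<and>
     Re (form_period D \<tau> c (b_cycle D $ j)) = snd \<alpha> $ j)"

text \<open>The square of the Hodge norm of the class of \<open>Re \<omega>\<close> is \<open>(i/2) \<langle>\<omega>, cnj \<omega>\<rangle>\<close> for the
  symplectic form on \<open>H\<^sup>1\<close> given by the polarization, written out in the symplectic basis as in
  Riemann's bilinear relations. On a Jacobian this is \<open>(i/2) \<integral> \<omega> \<and> cnj \<omega>\<close> over the curve.\<close>

definition hodge_norm :: "int \<Rightarrow> complex \<times> complex \<Rightarrow> coh1 \<Rightarrow> real" where
  "hodge_norm D \<tau> \<alpha> =
     (let \<omega> = form_period D \<tau> (holomorphic_rep D \<tau> \<alpha>) in
      sqrt (Re (\<i> / 2 * (\<Sum>j\<in>UNIV. \<omega> (a_cycle D $ j) * cnj (\<omega> (b_cycle D $ j))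
                                - \<omega> (b_cycle D $ j) * cnj (\<omega> (a_cycle D $ j))))))"

section \<open>Lyapunov exponents\<close>

text \<open>The unit tangent bundle of \<open>\<H>/\<Gamma>\<close> is the space of orbits \<open>\<Gamma> g\<close> with \<open>g \<in> SL\<^sub>2(\<real>)\<close>
  (the groups in question contain \<open>-1\<close>, so this is also \<open>PSL\<^sub>2(\<real>)\<close> modulo \<open>\<Gamma>\<close>); \<open>g\<close> has base
  point \<open>g i\<close>, and the geodesic flow in curvature \<open>-4\<close> is right multiplication by
  \<open>geodesic t\<close>.\<close>

definition geodesic :: "real \<Rightarrow> real^2^2" where
  "geodesic t = vector [vector [exp t, 0], vector [0, exp (- t)]]"

definition unit_tangent_point :: "(real^2^2) set \<Rightarrow> real^2^2 \<Rightarrow> (real^2^2) set" where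
  "unit_tangent_point \<Gamma> g = (\<lambda>\<gamma>. \<gamma> ** g) ` \<Gamma>"

text \<open>Haar measure of \<open>B \<subseteq> SL\<^sub>2(\<real>)\<close> is the Lebesgue measure of the cone
  \<open>{r g | 0 < r \<le> 1, g \<in> B}\<close> in the space of matrices; it is invariant because multiplication
  by a matrix of determinant one preserves Lebesgue measure on the space of matrices.\<close>

definition haar_SL2 :: "(real^2^2) measure" where
  "haar_SL2 = distr (restrict_space lborel {X. 0 < det X \<and> det X \<le> 1}) borel
                    (\<lambda>X. (1 / sqrt (det X)) *\<^sub>R X)"

text \<open>Since \<open>\<Gamma>\<close> is countable, a subset of the quotient is null for the invariant Liouville measure
  iff its preimage in \<open>SL\<^sub>2(\<real>)\<close> is null for Haar measure.\<close>

definition almost_every_unit_tangent ::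
    "(real^2^2) set \<Rightarrow> ((real^2^2) set \<Rightarrow> bool) \<Rightarrow> bool" where
  "almost_every_unit_tangent \<Gamma> P \<longleftrightarrow> (AE g in haar_SL2. P (unit_tangent_point \<Gamma> g))"

text \<open>\<open>F\<close> is the lift to \<open>\<H> \<rightarrow> \<H> \<times> \<H>\<^sup>-\<close> of a curve \<open>\<H>/\<Gamma> \<rightarrow> X\<^sub>D\<close>. On \<open>\<H> \<times> \<H>\<^sup>-\<close> the local
  system with fibres \<open>H\<^sup>1(A\<^sub>\<tau>, \<real>)\<close> is constant, so once a representative \<open>g\<close> of a point of the
  unit tangent bundle is chosen, the parallel transport of \<open>\<alpha>\<close> along the flow is \<open>\<alpha>\<close> itself
  and only its Hodge norm varies.\<close>

definition has_exponent ::
    "int \<Rightarrow> (complex \<Rightarrow> complex \<times> complex) \<Rightarrow> real^2^2 \<Rightarrow> coh1 \<Rightarrow> real \<Rightarrow> bool" where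
  "has_exponent D F g \<alpha> l \<longleftrightarrow>
     ((\<lambda>t. ln (hodge_norm D (F (mobius (g ** geodesic t) \<i>)) \<alpha>) / t) \<longlongrightarrow> l) at_top"

text \<open>\<open>L\<close> lists the Lyapunov exponents with multiplicity: almost everywhere, every non-zero vector
  has one of them as its growth rate, and the subspace of the Oseledets filtration of vectors
  with growth rate at most \<open>s\<close> has as dimension the number of exponents which are at most \<open>s\<close>.\<close>

definition lyapunov_exponents ::
    "int \<Rightarrow> (real^2^2) set \<Rightarrow> (complex \<Rightarrow> complex \<times> complex) \<Rightarrow> real multiset \<Rightarrow> bool" where
  "lyapunov_exponents D \<Gamma> F L \<longleftrightarrow>
     almost_every_unit_tangent \<Gamma> (\<lambda>x. \<forall>g\<in>x.
        (\<forall>\<alpha>. \<alpha> \<noteq> 0 \<longrightarrow> (\<exists>l\<in>#L. has_exponent D F g \<alpha> l)) \<and>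
        (\<forall>s. dim {\<alpha>. \<alpha> = 0 \<or> (\<exists>l\<le>s. has_exponent D F g \<alpha> l)} = size {# l \<in># L. l \<le> s #}))"

end

theory Submission
  imports Defs
begin

text \<open>The real \<open>4\<close>-space \<open>H\<^sup>1(A\<^sub>\<tau>, \<real>)\<close> splits into the two eigenspaces of the real
  multiplication, and on each of them the Hodge norm is the \<open>SL\<^sub>2(\<real>)\<close>-equivariant norm
  \<open>\<bar>u\<^sub>1 z - u\<^sub>2\<bar>\<^sup>2 / \<bar>Im z\<bar>\<close>. Hence \<open>(M, M\<^sup>\<sigma>)\<close>, rescaled to determinant one in each
  factor, carries the cocycle over the orbit of \<open>g\<close> for the twisted curve isometrically to the one
  over the orbit of \<open>M\<inverse> g\<close> for the original curve, by a linear isomorphism that is constant in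
  time. The growth rates therefore agree, and left translation preserves Haar null sets. The same
  argument applied to elements of the uniformizing groups shows that the choice of the
  representative \<open>g\<close> is immaterial.\<close>

section \<open>Inverses of real matrices\<close>

lemma matrix_inv_eqI:
  fixes A B :: "real^'n^'n"
  assumes "A ** B = mat 1" "B ** A = mat 1"
  shows "matrix_inv A = B"
  unfolding matrix_inv_def
proof (rule some_equality)
  fix C :: "real^'n^'n" assume "A ** C = mat 1 \<and> C ** A = mat 1"
  then show "C = B" using assms by (metis matrix_mul_assoc matrix_mul_lid matrix_mul_rid)
qed (use assms in auto)

lemma matrix_inv_inverse:
  fixes A :: "real^'n^'n"
  assumes "det A \<noteq> 0"
  shows "A ** matrix_inv A = mat 1" "matrix_inv A ** A = mat 1"
  using assms matrix_inv_eqI[of A] unfolding invertible_det_nz[symmetric] invertible_def by auto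

lemma det_scaleR_2:
  fixes A :: "real^2^2"
  shows "det (r *\<^sub>R A) = r\<^sup>2 * det A"
  by (simp add: det_2 power2_eq_square algebra_simps)

text \<open>The adjugate formula shows that the entries of \<open>matrix_inv M\<close> stay in the
  field generated by those of \<open>M\<close>.\<close>

lemma matrix_inv_2:
  fixes M :: "real^2^2"
  assumes "det M \<noteq> 0"
  shows "matrix_inv M = inverse (det M) *\<^sub>R
    vector [vector [M$2$2, - M$1$2], vector [- M$2$1, M$1$1]]" (is "_ = ?N")
proof -
  have "inverse (det M) * (M$1$1 * M$2$2 - M$1$2 * M$2$1) = 1"
    using assms by (simp add: det_2)
  then have "M ** ?N = mat 1" "?N ** M = mat 1"
    by (auto simp: vec_eq_iff forall_2 matrix_matrix_mult_def sum_2 mat_def algebra_simps)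
  then show ?thesis by (rule matrix_inv_eqI)
qed

section \<open>Real quadratic fields\<close>

lemma quad_fieldE:
  assumes "x \<in> quad_field D"
  obtains p q where "p \<in> \<rat>" "q \<in> \<rat>" "x = p + q * sqrt (of_int D)"
  using assms by (auto simp: quad_field_def)

lemma quad_fieldI:
  "p \<in> \<rat> \<Longrightarrow> q \<in> \<rat> \<Longrightarrow> x = p + q * sqrt (of_int D) \<Longrightarrow> x \<in> quad_field D"
  by (auto simp: quad_field_def)

lemma Rats_imp_quad_field: "x \<in> \<rat> \<Longrightarrow> x \<in> quad_field D"
  by (rule quad_fieldI[of x 0]) auto

context
  fixes D :: int
  assumes D_pos: "D > 0" and D_nonsquare: "\<nexists>n::int. D = n\<^sup>2"
begin

lemma galois_Rats: "x \<in> \<rat> \<Longrightarrow> galois D x = x"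
  using galois_eq[OF D_pos D_nonsquare, of x 0 x] by simp

lemma sqrt_disc_mult: "real_of_int D = sqrt (of_int D) * sqrt (of_int D)"
  using D_pos by simp

lemma quad_field_diff_galois:
  assumes "x \<in> quad_field D" "y \<in> quad_field D"
  shows "x - y \<in> quad_field D" "galois D (x - y) = galois D x - galois D y"
proof -
  obtain p q where x: "p \<in> \<rat>" "q \<in> \<rat>" "x = p + q * sqrt (of_int D)"
    using assms by (elim quad_fieldE)
  obtain p' q' where y: "p' \<in> \<rat>" "q' \<in> \<rat>" "y = p' + q' * sqrt (of_int D)"
    using assms by (elim quad_fieldE)
  have e: "x - y = (p - p') + (q - q') * sqrt (of_int D)"
    using x y by (simp add: algebra_simps)
  show "x - y \<in> quad_field D"
    by (rule quad_fieldI[OF _ _ e]) (use x y in auto)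
  show "galois D (x - y) = galois D x - galois D y"
    using galois_eq[OF D_pos D_nonsquare _ _ e] galois_eq[OF D_pos D_nonsquare x]
      galois_eq[OF D_pos D_nonsquare y] x y by (simp add: algebra_simps)
qed

lemma quad_field_mult_galois:
  assumes "x \<in> quad_field D" "y \<in> quad_field D"
  shows "x * y \<in> quad_field D" "galois D (x * y) = galois D x * galois D y"
proof -
  define s where "s = sqrt (of_int D)"
  have s: "real_of_int D = s * s" unfolding s_def by (rule sqrt_disc_mult)
  obtain p q where x: "p \<in> \<rat>" "q \<in> \<rat>" "x = p + q * s"
    using assms unfolding s_def by (elim quad_fieldE)
  obtain p' q' where y: "p' \<in> \<rat>" "q' \<in> \<rat>" "y = p' + q' * s"
    using assms unfolding s_def by (elim quad_fieldE)
  have e: "x * y = (p * p' + q * q' * of_int D) + (p * q' + q * p') * s"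
    unfolding s x y by (simp add: algebra_simps)
  show "x * y \<in> quad_field D"
    by (rule quad_fieldI[OF _ _ e[unfolded s_def]]) (use x y in auto)
  have xy: "galois D (x * y) = (p * p' + q * q' * of_int D) - (p * q' + q * p') * s"
    unfolding s_def by (rule galois_eq[OF D_pos D_nonsquare _ _ e[unfolded s_def]]) (use x y in auto)
  have gx: "galois D x = p - q * s" and gy: "galois D y = p' - q' * s"
    unfolding s_def using x y by (auto simp: s_def intro!: galois_eq[OF D_pos D_nonsquare])
  show "galois D (x * y) = galois D x * galois D y"
    unfolding xy gx gy s by (simp add: algebra_simps)
qed

lemma quad_field_uminus: "x \<in> quad_field D \<Longrightarrow> - x \<in> quad_field D"
  using quad_field_diff_galois(1)[of 0 x] by (simp add: Rats_imp_quad_field)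

lemma quad_field_add:
  "x \<in> quad_field D \<Longrightarrow> y \<in> quad_field D \<Longrightarrow> x + y \<in> quad_field D"
  using quad_field_diff_galois(1)[of x "- y"] by (simp add: quad_field_uminus)

lemma quad_field_inverse:
  assumes "x \<in> quad_field D"
  shows "inverse x \<in> quad_field D"
proof (cases "x = 0")
  case False
  obtain p q where x: "p \<in> \<rat>" "q \<in> \<rat>" "x = p + q * sqrt (of_int D)"
    using assms by (elim quad_fieldE)
  \<comment> \<open>The conjugate of \<open>x\<close>: it is non-zero because \<open>sqrt D\<close>
    is irrational, and \<open>x * y\<close> is the rational norm, so the inverse is a rational
    multiple of \<open>y\<close>.\<close>
  define y where "y = p - q * sqrt (of_int D)"
  have "y \<noteq> 0"
  proof
    assume y: "y = 0"
    show False
    proof (cases "q = 0")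
      case True
      then show False using y x \<open>x \<noteq> 0\<close> by (simp add: y_def)
    next
      case q: False
      then have "sqrt (of_int D) = p / q" using y by (simp add: y_def field_simps)
      then show False using x sqrt_disc_irrational[OF D_pos D_nonsquare] by simp
    qed
  qed
  moreover have n: "x * y = p * p - q * q * of_int D"
    unfolding x y_def by (subst (3) sqrt_disc_mult) (simp add: algebra_simps)
  ultimately have "inverse x = inverse (p * p - q * q * of_int D) * y"
    using False unfolding n[symmetric] by (simp add: field_simps)
  moreover have "inverse (p * p - q * q * of_int D) \<in> quad_field D"
    using x by (intro Rats_imp_quad_field) auto
  moreover have "y \<in> quad_field D"
    by (rule quad_fieldI[of p "- q"]) (use x in \<open>auto simp: y_def\<close>)
  ultimately show ?thesis by (metis quad_field_mult_galois(1))
qed (auto intro: Rats_imp_quad_field)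

lemma w_gen_in_quad_field: "w_gen D \<in> quad_field D"
  by (rule quad_fieldI[of "if D mod 4 = 1 then 1/2 else 0" "1/2"])
    (auto simp: w_gen_def field_simps)

lemma quad_order_subset: "quad_order D \<subseteq> quad_field D"
  unfolding quad_order_def
  by (auto intro!: quad_field_add quad_field_mult_galois w_gen_in_quad_field
      intro: Rats_imp_quad_field)

text \<open>The conjugates that \<open>period_map\<close> takes of the entries of
  \<open>a_cycle D\<close> and \<open>b_cycle D\<close> other than 0 and 1.\<close>

lemma galois_w_gen:
  "galois D (w_gen D) = w_gen D - sqrt (of_int D)"
  "galois D (- galois D (w_gen D)) = - w_gen D"
proof -
  let ?p = "if D mod 4 = 1 then 1/2 else 0 :: real"
  have w: "w_gen D = ?p + 1/2 * sqrt (of_int D)" by (auto simp: w_gen_def field_simps)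
  have g: "galois D (w_gen D) = ?p - 1/2 * sqrt (of_int D)"
    by (rule galois_eq[OF D_pos D_nonsquare _ _ w]) auto
  show "galois D (w_gen D) = w_gen D - sqrt (of_int D)" unfolding g unfolding w by simp
  have "galois D (- galois D (w_gen D)) = - ?p - 1/2 * sqrt (of_int D)"
    by (rule galois_eq[OF D_pos D_nonsquare]) (auto simp: g)
  then show "galois D (- galois D (w_gen D)) = - w_gen D" unfolding w by simp
qed

lemma det_galois_mat:
  assumes "\<And>i j. M $ i $ j \<in> quad_field D"
  shows "det (galois_mat D M) = galois D (det M)"
  using assms by (simp add: det_2 galois_mat_def quad_field_diff_galois quad_field_mult_galois)

lemma galois_mat_1: "galois_mat D (mat 1) = mat 1"
  by (simp add: galois_mat_def mat_def vec_eq_iff galois_Rats)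

lemma GL2_plus_det:
  assumes "M \<in> GL2_plus D"
  shows "det M > 0" "det (galois_mat D M) > 0"
  using assms det_galois_mat by (auto simp: GL2_plus_def)

lemma mat_1_GL2_plus: "mat 1 \<in> GL2_plus D"
  by (simp add: GL2_plus_def mat_def det_2 galois_Rats Rats_imp_quad_field)

text \<open>Conjugation by \<open>M\<close> can leave \<open>SL2_order D\<close>, but it keeps the
  entries in K and the determinant equal to 1, which is rational and hence its own conjugate. This
  is enough for equivariance of the Hodge norm.\<close>

lemma GL2_plus_conjugate:
  assumes M: "M \<in> GL2_plus D" and A: "A \<in> SL2_order D"
  shows "matrix_inv M ** A ** M \<in> GL2_plus D"
proof -
  have dM: "det M \<noteq> 0" using GL2_plus_det[OF M] by simp
  have Mk: "M $ i $ j \<in> quad_field D" for i j using M by (simp add: GL2_plus_def)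
  have Ak: "A $ i $ j \<in> quad_field D" for i j
    using A quad_order_subset by (auto simp: SL2_order_def)
  have "inverse (det M) \<in> quad_field D"
    unfolding det_2 by (intro quad_field_inverse quad_field_diff_galois quad_field_mult_galois Mk)
  then have "matrix_inv M $ i $ j \<in> quad_field D" for i j
    unfolding matrix_inv_2[OF dM] using exhaust_2[of i] exhaust_2[of j] Mk
    by (auto intro!: quad_field_mult_galois quad_field_uminus)
  then have K: "(matrix_inv M ** A ** M) $ i $ j \<in> quad_field D" for i j
    using Mk Ak unfolding matrix_matrix_mult_def
    by (simp add: sum_2 quad_field_add quad_field_mult_galois)
  have "matrix_inv M ** M = mat 1"
    using dM by (rule matrix_inv_inverse)
  then have "det (matrix_inv M) * det M = 1" by (metis det_I det_mul)
  then have "det (matrix_inv M ** A ** M) = 1"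
    using A by (simp add: det_mul SL2_order_def)
  then show ?thesis using K by (simp add: GL2_plus_def galois_Rats)
qed

end

section \<open>The Hodge norm in eigenform coordinates\<close>

text \<open>Splits a class according to the two embeddings of \<open>K\<close>: the first component consists of the
  real parts of the periods \<open>c\<^sub>1, c\<^sub>1 z\<^sub>1\<close> and the second of those of \<open>c\<^sub>2, c\<^sub>2 z\<^sub>2\<close>, where
  \<open>c\<^sub>1 du\<^sub>1 + c\<^sub>2 du\<^sub>2\<close> is the holomorphic representative. The splitting does not depend on
  the point \<open>(z\<^sub>1, z\<^sub>2)\<close>.\<close>

definition eigen_parts :: "int \<Rightarrow> coh1 \<Rightarrow> coh1" where
  "eigen_parts D \<alpha> =
     (let w = w_gen D; w' = galois D w; s = sqrt (of_int D) in
      (vector [(fst \<alpha> $ 2 - w' * fst \<alpha> $ 1) / s, (snd \<alpha> $ 1 + w * snd \<alpha> $ 2) / s],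
       vector [(w * fst \<alpha> $ 1 - fst \<alpha> $ 2) / s, (- snd \<alpha> $ 1 - w' * snd \<alpha> $ 2) / s]))"

lemma linear_eigen_parts: "linear (eigen_parts D)"
  by (rule linearI)
    (auto simp: eigen_parts_def Let_def prod_eq_iff vec_eq_iff forall_2 add_divide_distrib
      diff_divide_distrib algebra_simps)

text \<open>Equals \<open>|c|^2 * Im z\<close> for the complex number c with
  \<open>Re c = u$1\<close> and \<open>Re (c * z) = u$2\<close>. It carries the sign of
  \<open>Im z\<close>, so the second factor, where \<open>Im z\<close> is negative, enters the Hodge
  norm with a minus sign.\<close>

definition eigen_norm :: "complex \<Rightarrow> real^2 \<Rightarrow> real" where
  "eigen_norm z u = (cmod (of_real (u$1) * z - of_real (u$2)))\<^sup>2 / Im z"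

lemma Re_period_unique:
  assumes "Im z \<noteq> 0"
  shows "Re c = x \<and> Re (c * z) = y \<longleftrightarrow> c = Complex x ((x * Re z - y) / Im z)"
  using assms by (auto simp: complex_eq_iff field_simps)

lemma eigen_norm_eq:
  assumes "Im z \<noteq> 0"
  shows "eigen_norm z u = (cmod (Complex (u$1) ((u$1 * Re z - u$2) / Im z)))\<^sup>2 * Im z"
proof -
  have "(x\<^sup>2 + (y / i)\<^sup>2) * i = (y\<^sup>2 + (x * i)\<^sup>2) / i" if "i \<noteq> 0" for x y i :: real
    using that by (simp add: field_simps power2_eq_square)
  with assms show ?thesis by (simp add: eigen_norm_def cmod_power2)
qed

context
  fixes D :: int
  assumes D_pos: "D > 0" and D_nonsquare: "\<nexists>n::int. D = n\<^sup>2"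
begin

text \<open>The equations on the right split the periods along the symplectic basis into
  contributions of the two embeddings; \<open>eigen_parts\<close> is their solution by Cramer's
  rule.\<close>

lemma eigen_parts_unique:
  "eigen_parts D \<alpha> = (u, v) \<longleftrightarrow>
     u$1 + v$1 = fst \<alpha> $ 1 \<and> w_gen D * u$1 + galois D (w_gen D) * v$1 = fst \<alpha> $ 2 \<and>
     - galois D (w_gen D) * u$2 - w_gen D * v$2 = snd \<alpha> $ 1 \<and> u$2 + v$2 = snd \<alpha> $ 2"
proof -
  define w s where "w = w_gen D" and "s = sqrt (of_int D)"
  have s: "s \<noteq> 0" using D_pos by (simp add: s_def)
  have w': "galois D w = w - s" using galois_w_gen[OF D_pos D_nonsquare] by (simp add: w_def s_def)
  \<comment> \<open>One system of determinant \<open>-s\<close> serves twice: for the a-periods,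
    and, after a sign change and an exchange of u and v, for the b-periods.\<close>
  have a: "a2 - (w - s) * a1 = u1 * s \<and> w * a1 - a2 = v1 * s \<longleftrightarrow>
        u1 + v1 = a1 \<and> w * u1 + (w - s) * v1 = a2" for a1 a2 u1 v1 :: real
  proof
    assume h: "a2 - (w - s) * a1 = u1 * s \<and> w * a1 - a2 = v1 * s"
    then have "s * (u1 + v1) = s * a1" by (simp add: algebra_simps)
    then have "u1 + v1 = a1" using s by simp
    then show "u1 + v1 = a1 \<and> w * u1 + (w - s) * v1 = a2" using h by (auto simp: algebra_simps)
  qed (auto simp: algebra_simps)
  show ?thesis
    unfolding eigen_parts_def Let_def w_def[symmetric] s_def[symmetric] w'
    using s a[of "fst \<alpha> $ 2" "fst \<alpha> $ 1" "u $ 1" "v $ 1"]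
      a[of "- snd \<alpha> $ 1" "snd \<alpha> $ 2" "v $ 2" "u $ 2"]
    by (simp add: vec_eq_iff forall_2 divide_eq_eq) (smt (verit) minus_mult_left)
qed

lemma bij_eigen_parts: "bij (eigen_parts D)"
proof -
  have "inj (eigen_parts D)"
  proof (rule injI)
    fix \<alpha> \<beta> assume e: "eigen_parts D \<alpha> = eigen_parts D \<beta>"
    obtain u v where "eigen_parts D \<alpha> = (u, v)" by fastforce
    with e have "fst \<alpha> = fst \<beta>" "snd \<alpha> = snd \<beta>"
      using eigen_parts_unique[of \<alpha> u v] eigen_parts_unique[of \<beta> u v]
      by (auto simp: vec_eq_iff forall_2)
    then show "\<alpha> = \<beta>" by (simp add: prod_eq_iff)
  qed
  then show ?thesis
    using linear_injective_imp_surjective[OF linear_eigen_parts] by (simp add: bij_def)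
qed

lemma hodge_norm_eigen_norm:
  assumes z: "Im z1 \<noteq> 0" "Im z2 \<noteq> 0"
  shows "hodge_norm D (z1, z2) \<alpha> =
    sqrt (sqrt (of_int D) * (eigen_norm z1 (fst (eigen_parts D \<alpha>)) - eigen_norm z2 (snd (eigen_parts D \<alpha>))))"
proof -
  define w s where "w = w_gen D" and "s = sqrt (of_int D)"
  have w': "galois D w = w - s" "galois D (s - w) = - w"
    using galois_w_gen[OF D_pos D_nonsquare] by (auto simp: w_def s_def)
  have g01: "galois D 0 = 0" "galois D 1 = 1" by (simp_all add: galois_Rats[OF D_pos D_nonsquare])
  obtain u v where uv: "eigen_parts D \<alpha> = (u, v)" by fastforce
  note form = form_period_def period_map_def a_cycle_def b_cycle_def w_def[symmetric] g01 w'
  have periods: "form_period D (z1, z2) c (a_cycle D $ 1) = fst c + snd c"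
    "form_period D (z1, z2) c (a_cycle D $ 2) = w * fst c + (w - s) * snd c"
    "form_period D (z1, z2) c (b_cycle D $ 1) = - (w - s) * (fst c * z1) - w * (snd c * z2)"
    "form_period D (z1, z2) c (b_cycle D $ 2) = fst c * z1 + snd c * z2"
    for c :: "complex \<times> complex"
    by (simp_all add: form algebra_simps)
  \<comment> \<open>Each coefficient of the holomorphic representative is determined within its own
    eigenspace, by \<open>Re_period_unique\<close>.\<close>
  define c1 where "c1 = Complex (u$1) ((u$1 * Re z1 - u$2) / Im z1)"
  define c2 where "c2 = Complex (v$1) ((v$1 * Re z2 - v$2) / Im z2)"
  have rep: "holomorphic_rep D (z1, z2) \<alpha> = (c1, c2)"
  proof -
    have "(\<forall>j. Re (form_period D (z1, z2) c (a_cycle D $ j)) = fst \<alpha> $ j \<and>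
            Re (form_period D (z1, z2) c (b_cycle D $ j)) = snd \<alpha> $ j) \<longleftrightarrow> c = (c1, c2)" for c
    proof -
      have "(\<forall>j. Re (form_period D (z1, z2) c (a_cycle D $ j)) = fst \<alpha> $ j \<and>
            Re (form_period D (z1, z2) c (b_cycle D $ j)) = snd \<alpha> $ j) \<longleftrightarrow>
          eigen_parts D \<alpha> = (vector [Re (fst c), Re (fst c * z1)], vector [Re (snd c), Re (snd c * z2)])"
        unfolding eigen_parts_unique forall_2 periods w_def[symmetric] w'
        by (auto simp: algebra_simps)
      also have "\<dots> \<longleftrightarrow> (Re (fst c) = u$1 \<and> Re (fst c * z1) = u$2) \<and>
                        (Re (snd c) = v$1 \<and> Re (snd c * z2) = v$2)"
        unfolding uv by (auto simp: vec_eq_iff forall_2)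
      also have "\<dots> \<longleftrightarrow> c = (c1, c2)"
        unfolding Re_period_unique[OF z(1)] Re_period_unique[OF z(2)]
        by (auto simp: c1_def c2_def prod_eq_iff)
      finally show ?thesis .
    qed
    then show ?thesis by (simp add: holomorphic_rep_def)
  qed
  \<comment> \<open>The eigenspaces are orthogonal: the mixed terms carry the coefficients
    \<open>w - w\<close> and \<open>(w - s) - (w - s)\<close>, while the pure ones carry
    \<open>s\<close> and \<open>-s\<close>.\<close>
  have "Re (\<i> / 2 * (\<Sum>j\<in>UNIV. form_period D (z1, z2) c (a_cycle D $ j) * cnj (form_period D (z1, z2) c (b_cycle D $ j))
           - form_period D (z1, z2) c (b_cycle D $ j) * cnj (form_period D (z1, z2) c (a_cycle D $ j))))
      = s * ((cmod (fst c))\<^sup>2 * Im z1 - (cmod (snd c))\<^sup>2 * Im z2)" for c :: "complex \<times> complex"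
  proof -
    have "Re (\<i> / 2 * x) = - Im x / 2" for x by simp
    then show ?thesis
      unfolding sum_2 periods cmod_power2
      by (simp add: algebra_simps power2_eq_square add_divide_distrib diff_divide_distrib)
  qed
  then have "hodge_norm D (z1, z2) \<alpha> = sqrt (s * ((cmod c1)\<^sup>2 * Im z1 - (cmod c2)\<^sup>2 * Im z2))"
    by (simp add: hodge_norm_def rep Let_def)
  moreover have "(cmod c1)\<^sup>2 * Im z1 = eigen_norm z1 u" "(cmod c2)\<^sup>2 * Im z2 = eigen_norm z2 v"
    by (simp_all only: c1_def c2_def eigen_norm_eq[OF z(1)] eigen_norm_eq[OF z(2)])
  ultimately show ?thesis by (simp add: uv s_def)
qed

end

section \<open>Moebius transformations and their effect on the norms of the eigenspaces\<close>

lemma mobius_denom_nonzero: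
  fixes A :: "real^2^2"
  assumes "Im z \<noteq> 0" "det A \<noteq> 0"
  shows "complex_of_real (A$2$1) * z + of_real (A$2$2) \<noteq> 0"
  using assms by (auto simp: complex_eq_iff det_2)

lemma Im_mobius:
  assumes "Im z \<noteq> 0" "det A \<noteq> 0"
  shows "Im (mobius A z) = det A * Im z / (cmod (of_real (A$2$1) * z + of_real (A$2$2)))\<^sup>2"
  unfolding mobius_def Im_divide cmod_power2
  by (simp add: det_2 algebra_simps power2_eq_square)

lemma mobius_mult:
  assumes "Im z \<noteq> 0" "det A \<noteq> 0" "det B \<noteq> 0"
  shows "mobius (A ** B) z = mobius A (mobius B z)"
proof -
  define x where "x = complex_of_real (B$1$1) * z + of_real (B$1$2)"
  define y where "y = complex_of_real (B$2$1) * z + of_real (B$2$2)"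
  have y: "y \<noteq> 0" using assms by (simp add: y_def mobius_denom_nonzero)
  have "a * (x / y) + b = (a * x + b * y) / y" for a b
    using y by (simp add: add_divide_distrib)
  then have "mobius A (mobius B z) = ((A$1$1 * x + A$1$2 * y) / y) / ((A$2$1 * x + A$2$2 * y) / y)"
    by (simp only: mobius_def x_def y_def)
  also have "\<dots> = (A$1$1 * x + A$1$2 * y) / (A$2$1 * x + A$2$2 * y)"
    using y by simp
  also have "\<dots> = mobius (A ** B) z"
    by (simp add: mobius_def matrix_matrix_mult_def sum_2 x_def y_def algebra_simps)
  finally show ?thesis by simp
qed

lemma mobius_scaleR: "r \<noteq> 0 \<Longrightarrow> mobius (r *\<^sub>R A) z = mobius A z"
proof -
  assume r: "r \<noteq> 0"
  have "mobius (r *\<^sub>R A) z =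
      (of_real r * (of_real (A$1$1) * z + of_real (A$1$2))) / (of_real r * (of_real (A$2$1) * z + of_real (A$2$2)))"
    by (simp add: mobius_def algebra_simps)
  then show ?thesis using r by (simp add: mobius_def)
qed

lemma mobius_mat_1: "mobius (mat 1) z = z"
  by (simp add: mobius_def mat_def)

text \<open>The change of the coefficients of \<open>u$1 * z - u$2\<close> when
  \<open>mobius A z\<close> replaces z and the denominator is cleared, scaled to determinant one for
  \<open>det A > 0\<close>.\<close>

definition eigen_action :: "real^2^2 \<Rightarrow> real^2^2" where
  "eigen_action A = (1 / sqrt (det A)) *\<^sub>R
     vector [vector [A$1$1, - A$2$1], vector [- A$1$2, A$2$2]]"

text \<open>The factor \<open>|A$2$1 * z + A$2$2|^2\<close> appears in the denominators of both the
  squared modulus and \<open>Im (mobius A z)\<close> and cancels; the remaining \<open>det A\<close>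
  is absorbed by the scaling in \<open>eigen_action\<close>.\<close>

lemma eigen_norm_mobius:
  assumes z: "Im z \<noteq> 0" and d: "det A > 0"
  shows "eigen_norm (mobius A z) u = eigen_norm z (eigen_action A *v u)"
proof -
  define j where "j = complex_of_real (A$2$1) * z + of_real (A$2$2)"
  define n where "n = complex_of_real (u$1 * A$1$1 - u$2 * A$2$1) * z - of_real (u$2 * A$2$2 - u$1 * A$1$2)"
  have j: "j \<noteq> 0" using z d by (simp add: mobius_denom_nonzero j_def)
  have "of_real (u$1) * mobius A z - of_real (u$2) =
      (of_real (u$1) * (of_real (A$1$1) * z + of_real (A$1$2)) - of_real (u$2) * j) / j"
    using j by (simp add: mobius_def diff_divide_distrib j_def[symmetric])
  also have "\<dots> = n / j" by (simp add: n_def j_def algebra_simps)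
  finally have "eigen_norm (mobius A z) u = (cmod (n / j))\<^sup>2 / Im (mobius A z)"
    by (simp only: eigen_norm_def)
  also have "Im (mobius A z) = det A * Im z / (cmod j)\<^sup>2"
    using z d unfolding j_def by (intro Im_mobius) auto
  also have "(cmod (n / j))\<^sup>2 / (det A * Im z / (cmod j)\<^sup>2) = (cmod n)\<^sup>2 / (det A * Im z)"
    using j by (simp add: norm_divide power_divide)
  also have "\<dots> = (cmod (of_real (1 / sqrt (det A)) * n))\<^sup>2 / Im z"
  proof -
    have "(cmod (of_real (1 / sqrt (det A)) * n))\<^sup>2 = (cmod n)\<^sup>2 / det A"
      using d by (simp add: norm_mult norm_divide power_divide)
    then show ?thesis by simp
  qed
  also have "of_real (1 / sqrt (det A)) * n =
      of_real ((eigen_action A *v u) $ 1) * z - of_real ((eigen_action A *v u) $ 2)"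
    by (simp add: eigen_action_def matrix_vector_mult_def sum_2 n_def diff_divide_distrib algebra_simps)
  finally show ?thesis by (simp only: eigen_norm_def)
qed

lemma invertible_eigen_action:
  assumes "det A > 0"
  shows "invertible (eigen_action A)"
proof -
  have "det (eigen_action A) = (1 / sqrt (det A))\<^sup>2 * det A"
    unfolding eigen_action_def det_scaleR_2 by (simp add: det_2)
  then have "det (eigen_action A) \<noteq> 0" using assms by simp
  then show ?thesis by (simp add: invertible_det_nz)
qed

text \<open>After rescaling to determinant one, \<open>M\<close> and \<open>M\<^sup>\<sigma>\<close> act isometrically on the two
  eigenspaces, so that the Hodge norms at \<open>\<tau>\<close> and at the image of \<open>\<tau>\<close> under \<open>(M, M\<^sup>\<sigma>)\<close> differ
  by a linear map that does not depend on \<open>\<tau>\<close>.\<close>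

lemma hodge_norm_equivariant:
  fixes D :: int
  assumes D: "D > 0" "\<nexists>n::int. D = n\<^sup>2" and M: "M \<in> GL2_plus D"
  obtains T where "linear T" "bij T"
    "\<And>z1 z2 \<alpha>. Im z1 \<noteq> 0 \<Longrightarrow> Im z2 \<noteq> 0 \<Longrightarrow>
       hodge_norm D (mobius M z1, mobius (galois_mat D M) z2) \<alpha> = hodge_norm D (z1, z2) (T \<alpha>)"
proof -
  define G where "G = eigen_parts D"
  define N where "N = galois_mat D M"
  have d: "det M > 0" "det N > 0" using GL2_plus_det[OF D M] by (auto simp: N_def)
  define H :: "coh1 \<Rightarrow> coh1" where
    "H = (\<lambda>x. (eigen_action M *v fst x, eigen_action N *v snd x))"
  have linH: "linear H"
    by (rule linearI) (auto simp: H_def prod_eq_iff matrix_vector_right_distrib matrix_vector_mult_scaleR)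
  have injH: "inj H"
  proof (rule injI)
    fix x y assume "H x = H y"
    then have "fst x = fst y" "snd x = snd y"
      using injD[OF inj_matrix_vector_mult[OF invertible_eigen_action[OF d(1)]], of "fst x" "fst y"]
        injD[OF inj_matrix_vector_mult[OF invertible_eigen_action[OF d(2)]], of "snd x" "snd y"]
      by (simp_all add: H_def)
    then show "x = y" by (simp add: prod_eq_iff)
  qed
  have linG: "linear G" and bijG: "bij G"
    using linear_eigen_parts bij_eigen_parts[OF D] by (auto simp: G_def)
  have bijH: "bij H"
    using injH linear_injective_imp_surjective[OF linH injH] by (simp add: bij_def)
  have lininv: "linear (inv G)"
    using linG bijG by (meson bij_def inj_linear_imp_inv_linear)
  show ?thesis
  proof (rule that[of "inv G \<circ> H \<circ> G"])
    show "linear (inv G \<circ> H \<circ> G)" by (intro linear_compose linG linH lininv)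
    show "bij (inv G \<circ> H \<circ> G)" by (intro bij_comp bijG bijH bij_imp_bij_inv)
    fix z1 z2 \<alpha> assume z: "Im z1 \<noteq> 0" "Im z2 \<noteq> 0"
    have "G ((inv G \<circ> H \<circ> G) \<alpha>) = H (G \<alpha>)"
      using bijG by (simp add: bij_def surj_f_inv_f)
    moreover have "Im (mobius M z1) \<noteq> 0" "Im (mobius N z2) \<noteq> 0"
      using z d mobius_denom_nonzero[of z1 M] mobius_denom_nonzero[of z2 N] by (auto simp: Im_mobius)
    ultimately show "hodge_norm D (mobius M z1, mobius (galois_mat D M) z2) \<alpha> =
        hodge_norm D (z1, z2) ((inv G \<circ> H \<circ> G) \<alpha>)"
      using z d by (simp add: hodge_norm_eigen_norm[OF D] G_def[symmetric] N_def[symmetric]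
          eigen_norm_mobius H_def)
  qed
qed

section \<open>Oseledets regular points\<close>

text \<open>The condition of \<open>lyapunov_exponents\<close> at a single matrix, isolated so that
  orbits and null sets can be treated separately.\<close>

definition oseledets_at ::
    "int \<Rightarrow> (complex \<Rightarrow> complex \<times> complex) \<Rightarrow> real multiset \<Rightarrow> real^2^2 \<Rightarrow> bool" where
  "oseledets_at D F L g \<longleftrightarrow>
     (\<forall>\<alpha>. \<alpha> \<noteq> 0 \<longrightarrow> (\<exists>l\<in>#L. has_exponent D F g \<alpha> l)) \<and>
     (\<forall>s. dim {\<alpha>. \<alpha> = 0 \<or> (\<exists>l\<le>s. has_exponent D F g \<alpha> l)} = size {# l \<in># L. l \<le> s #})"

text \<open>T maps the non-zero vectors onto the non-zero vectors and each step of the filtration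
  onto the corresponding one, and an injective linear map preserves \<open>dim\<close>.\<close>

lemma oseledets_at_linear_iso:
  assumes T: "linear T" "bij T"
    and e: "\<And>\<alpha> l. has_exponent D F g \<alpha> l \<longleftrightarrow> has_exponent D F' g' (T \<alpha>) l"
  shows "oseledets_at D F L g \<longleftrightarrow> oseledets_at D F' L g'"
proof -
  have T0: "T \<alpha> = 0 \<longleftrightarrow> \<alpha> = 0" for \<alpha>
    using T by (metis bij_def linear_injective_0 linear_0)
  have "(\<forall>\<alpha>. P (T \<alpha>)) \<longleftrightarrow> (\<forall>\<alpha>. P \<alpha>)" for P
    using bij_is_surj[OF T(2)] by (metis surjD)
  from this[of "\<lambda>\<alpha>. \<alpha> \<noteq> 0 \<longrightarrow> (\<exists>l\<in>#L. has_exponent D F' g' \<alpha> l)"]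
  have "(\<forall>\<alpha>. \<alpha> \<noteq> 0 \<longrightarrow> (\<exists>l\<in>#L. has_exponent D F g \<alpha> l)) \<longleftrightarrow>
        (\<forall>\<alpha>. \<alpha> \<noteq> 0 \<longrightarrow> (\<exists>l\<in>#L. has_exponent D F' g' \<alpha> l))"
    by (simp add: e T0)
  moreover have "dim {\<alpha>. \<alpha> = 0 \<or> (\<exists>l\<le>s. has_exponent D F g \<alpha> l)} =
      dim {\<alpha>. \<alpha> = 0 \<or> (\<exists>l\<le>s. has_exponent D F' g' \<alpha> l)}" (is "dim ?A = dim ?B") for s
  proof -
    have A: "?A = T -` ?B" by (auto simp: e T0)
    have "T ` ?A = ?B" unfolding A by (rule surj_image_vimage_eq[OF bij_is_surj[OF T(2)]])
    moreover have "dim (T ` ?A) = dim ?A"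
      using bij_is_inj[OF T(2)] by (intro dim_image_eq[OF T(1)]) (rule inj_on_subset, auto)
    ultimately show ?thesis by simp
  qed
  ultimately show ?thesis unfolding oseledets_at_def by simp
qed

text \<open>The isomorphism T of \<open>hodge_norm_equivariant\<close> is the same for all t, so the
  norms of \<alpha> and \<open>T \<alpha>\<close> agree along the entire geodesic. This serves both
  to undo the twist and to compare points of one orbit.\<close>

lemma oseledets_at_translate:
  assumes D: "D > 0" "\<nexists>n::int. D = n\<^sup>2" and M: "M \<in> GL2_plus D"
    and F: "\<And>t. Im (fst (F' (mobius (g' ** geodesic t) \<i>))) \<noteq> 0"
      "\<And>t. Im (snd (F' (mobius (g' ** geodesic t) \<i>))) \<noteq> 0"
      "\<And>t. F (mobius (g ** geodesic t) \<i>) =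
         map_prod (mobius M) (mobius (galois_mat D M)) (F' (mobius (g' ** geodesic t) \<i>))"
  shows "oseledets_at D F L g \<longleftrightarrow> oseledets_at D F' L g'"
proof -
  obtain T where T: "linear T" "bij T"
    "\<And>z1 z2 \<alpha>. Im z1 \<noteq> 0 \<Longrightarrow> Im z2 \<noteq> 0 \<Longrightarrow>
       hodge_norm D (mobius M z1, mobius (galois_mat D M) z2) \<alpha> = hodge_norm D (z1, z2) (T \<alpha>)"
    using hodge_norm_equivariant[OF D M] by blast
  have "hodge_norm D (F (mobius (g ** geodesic t) \<i>)) \<alpha> =
        hodge_norm D (F' (mobius (g' ** geodesic t) \<i>)) (T \<alpha>)" for t \<alpha>
    using T(3)[OF F(1,2)] by (simp add: F(3) map_prod_def case_prod_unfold)
  then show ?thesis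
    by (intro oseledets_at_linear_iso[OF T(1,2)]) (simp add: has_exponent_def)
qed

lemma det_geodesic: "det (geodesic t) = 1"
  by (simp add: geodesic_def det_2 flip: exp_add)

lemma Im_mobius_geodesic: "det g > 0 \<Longrightarrow> Im (mobius (g ** geodesic t) \<i>) > 0"
  using mobius_denom_nonzero[of \<i> "g ** geodesic t"]
  by (simp add: Im_mobius det_mul det_geodesic)

lemma mobius_geodesic_mult:
  assumes "det g > 0" "det A \<noteq> 0"
  shows "mobius (A ** g ** geodesic t) \<i> = mobius A (mobius (g ** geodesic t) \<i>)"
  using assms by (simp add: mobius_mult det_mul det_geodesic flip: matrix_mul_assoc)

text \<open>Scalars act trivially on the half plane, so a translating matrix may be normalized to
  determinant one.\<close>

lemma oseledets_at_scaleR: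
  assumes "r \<noteq> 0"
  shows "oseledets_at D F L (r *\<^sub>R g) \<longleftrightarrow> oseledets_at D F L g"
proof -
  have "(r *\<^sub>R g) ** h = r *\<^sub>R (g ** h)" for h :: "real^2^2"
    by (simp add: scalar_matrix_assoc)
  then show ?thesis
    using assms by (simp add: oseledets_at_def has_exponent_def mobius_scaleR)
qed

section \<open>Null sets of the Haar measure\<close>

lemma borel_measurable_det [measurable]: "(det :: real^2^2 \<Rightarrow> real) \<in> borel_measurable borel"
  unfolding det_2[abs_def] by (intro borel_measurable_continuous_onI continuous_intros)

lemma measurable_unimodular_part:
  "(\<lambda>X::real^2^2. (1 / sqrt (det X)) *\<^sub>R X) \<in> borel_measurable borel"
  by (intro borel_measurable_scaleR) measurable

lemma unimodular_domain_sets: "{X::real^2^2. 0 < det X \<and> det X \<le> 1} \<in> sets borel"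
  by measurable

text \<open>A Borel set is Haar null exactly when the cone over it is Lebesgue null, which makes
  results on \<open>negligible\<close> sets applicable.\<close>

lemma AE_haar_SL2:
  assumes "{g. P g} \<in> sets borel"
  shows "(AE g in haar_SL2. P g) \<longleftrightarrow>
    negligible {X. 0 < det X \<and> det X \<le> 1 \<and> \<not> P ((1 / sqrt (det X)) *\<^sub>R X)}"
    (is "_ \<longleftrightarrow> negligible ?N")
proof -
  define S :: "(real^2^2) set" where "S = {X. 0 < det X \<and> det X \<le> 1}"
  have S: "S \<in> sets borel" using unimodular_domain_sets by (simp add: S_def)
  have m: "(\<lambda>X::real^2^2. (1 / sqrt (det X)) *\<^sub>R X) \<in> measurable (restrict_space lborel S) borel"
    using measurable_unimodular_part by (intro measurable_restrict_space1) simp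
  have "(AE g in haar_SL2. P g) \<longleftrightarrow>
      (AE X in restrict_space lborel S. P ((1 / sqrt (det X)) *\<^sub>R X))"
    unfolding haar_SL2_def S_def[symmetric] using assms by (intro AE_distr_iff m) simp
  also have "\<dots> \<longleftrightarrow> (AE X in lborel. X \<in> S \<longrightarrow> P ((1 / sqrt (det X)) *\<^sub>R X))"
    using S by (intro AE_restrict_space_iff) simp
  also have "\<dots> \<longleftrightarrow> {X. \<not> (X \<in> S \<longrightarrow> P ((1 / sqrt (det X)) *\<^sub>R X))} \<in> null_sets lborel"
  proof -
    have "{X. \<not> (X \<in> S \<longrightarrow> P ((1 / sqrt (det X)) *\<^sub>R X))} =
        S - (\<lambda>X. (1 / sqrt (det X)) *\<^sub>R X) -` {g. P g}" by auto
    moreover have "(\<lambda>X. (1 / sqrt (det X)) *\<^sub>R X) -` {g. P g} \<in> sets borel"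
      using measurable_sets_borel[OF measurable_unimodular_part assms] .
    ultimately show ?thesis using S by (subst AE_iff_null) auto
  qed
  also have "{X. \<not> (X \<in> S \<longrightarrow> P ((1 / sqrt (det X)) *\<^sub>R X))} = ?N" by (auto simp: S_def)
  \<comment> \<open>\<open>negligible\<close> refers to the completed measure; on Borel sets both
    notions of null set agree.\<close>
  also have "?N \<in> null_sets lborel \<longleftrightarrow> negligible ?N"
  proof -
    have "?N = S - (\<lambda>X. (1 / sqrt (det X)) *\<^sub>R X) -` {g. P g}" by (auto simp: S_def)
    then have "?N \<in> sets lborel"
      using S measurable_sets_borel[OF measurable_unimodular_part assms] by simp
    then show ?thesis
      unfolding negligible_iff_null_sets by (simp add: null_sets_completion_iff)
  qed
  finally show ?thesis .
qed

text \<open>\<open>haar_SL2\<close> lives on the space of all matrices, but the radial projection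
  lands in determinant one.\<close>

lemma AE_haar_SL2_det: "AE g in haar_SL2. det g = 1"
proof -
  have "{g::real^2^2. det g = 1} \<in> sets borel" by measurable
  moreover have "det ((1 / sqrt (det X)) *\<^sub>R X) = 1" if "det X > 0" for X :: "real^2^2"
    using that by (simp add: det_scaleR_2 power_divide)
  then have "{X::real^2^2. 0 < det X \<and> det X \<le> 1 \<and> det ((1 / sqrt (det X)) *\<^sub>R X) \<noteq> 1} = {}" by auto
  ultimately show ?thesis by (subst AE_haar_SL2) (simp_all only: negligible_empty)
qed

text \<open>Only the class of null sets matters here, and it is preserved by every invertible linear map,
  so the invariance of the measure itself is not needed.\<close>

lemma AE_haar_SL2_translate:
  assumes A: "det A = 1" and ae: "AE g in haar_SL2. P g"
  shows "AE g in haar_SL2. P (A ** g)"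
proof -
  \<comment> \<open>P need not be measurable, so its exceptional set is enlarged to a Borel null
    set.\<close>
  obtain N where N: "N \<in> null_sets haar_SL2" "{g \<in> space haar_SL2. \<not> P g} \<subseteq> N"
    using ae by (auto simp: eventually_ae_filter)
  have PN: "P g" if "g \<notin> N" for g using N(2) that by (auto simp: haar_SL2_def)
  have Nb: "N \<in> sets borel" using N(1) by (auto simp: haar_SL2_def)
  let ?p = "\<lambda>X::real^2^2. (1 / sqrt (det X)) *\<^sub>R X"
  obtain B where B: "A ** B = mat 1" "B ** A = mat 1"
    using A invertible_det_nz[of A] unfolding invertible_def by auto
  have "AE g in haar_SL2. g \<notin> N" using N(1) AE_not_in by blast
  then have "negligible {X. 0 < det X \<and> det X \<le> 1 \<and> \<not> ?p X \<notin> N}" (is "negligible ?X")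
    by (subst (asm) AE_haar_SL2) (use Nb in \<open>auto simp flip: Compl_eq\<close>)
  moreover have linB: "linear (\<lambda>X. B ** X)"
    by (rule linearI) (auto simp: matrix_add_ldistrib matrix_scalar_ac scalar_matrix_assoc)
  ultimately have "negligible ((\<lambda>X. B ** X) ` ?X)"
    by (intro negligible_differentiable_image_negligible)
      (auto intro!: linear_imp_differentiable_on)
  \<comment> \<open>Multiplication by A preserves the determinant, hence commutes with the radial
    projection, so the new cone is the preimage of the old one under A.\<close>
  moreover have "{X. 0 < det X \<and> det X \<le> 1 \<and> \<not> A ** ?p X \<notin> N} \<subseteq> (\<lambda>X. B ** X) ` ?X"
  proof
    fix X assume X: "X \<in> {X. 0 < det X \<and> det X \<le> 1 \<and> \<not> A ** ?p X \<notin> N}"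
    have "det (A ** X) = det X" using A by (simp add: det_mul)
    moreover have "?p (A ** X) = A ** ?p X"
      using A by (simp add: det_mul matrix_scalar_ac scalar_matrix_assoc)
    ultimately have "A ** X \<in> ?X" using X by auto
    moreover have "X = B ** (A ** X)" using B by (simp add: matrix_mul_assoc)
    ultimately show "X \<in> (\<lambda>X. B ** X) ` ?X" by blast
  qed
  ultimately have "negligible {X. 0 < det X \<and> det X \<le> 1 \<and> \<not> A ** ?p X \<notin> N}"
    using negligible_subset by blast
  moreover have "{g. A ** g \<notin> N} \<in> sets borel"
  proof -
    have "linear (\<lambda>X. A ** X)"
      by (rule linearI) (auto simp: matrix_add_ldistrib matrix_scalar_ac scalar_matrix_assoc)
    then have "(\<lambda>X. A ** X) \<in> borel_measurable borel"
      by (intro borel_measurable_continuous_onI linear_continuous_on linear_linear[THEN iffD1])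
        (simp add: linear_conv_bounded_linear)
    then have "(\<lambda>X. A ** X) -` (- N) \<in> sets borel"
      using Nb by (intro measurable_sets_borel) auto
    then show ?thesis by (simp add: vimage_def)
  qed
  ultimately have "AE g in haar_SL2. A ** g \<notin> N" by (subst AE_haar_SL2) auto
  then show ?thesis by eventually_elim (rule PN)
qed

lemma AE_haar_SL2_translate_iff:
  assumes A: "det A = 1"
  shows "(AE g in haar_SL2. P (A ** g)) \<longleftrightarrow> (AE g in haar_SL2. P g)"
proof
  obtain B where B: "A ** B = mat 1"
    using A invertible_det_nz[of A] unfolding invertible_def by auto
  then have "det B = 1" using A det_mul[of A B] by simp
  then show "AE g in haar_SL2. P g" if "AE g in haar_SL2. P (A ** g)"
    using AE_haar_SL2_translate[of B "\<lambda>g. P (A ** g)"] that B by (simp add: matrix_mul_assoc)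
qed (rule AE_haar_SL2_translate[OF A])

section \<open>Twisted curves\<close>

text \<open>The right-hand side does not mention M, so any two twists have the same
  exponents.\<close>

lemma lyapunov_exponents_twisted:
  fixes D :: int
  assumes D: "D > 0" "\<nexists>n::int. D = n\<^sup>2" and M: "M \<in> GL2_plus D"
    and \<phi>: "\<phi> ` upper_half_plane \<subseteq> lower_half_plane"
  shows "lyapunov_exponents D (twisted_group D \<phi> M) (twisted_map D \<phi> M) L \<longleftrightarrow>
    (AE g in haar_SL2. oseledets_at D (graph_map \<phi>) L g)"
proof -
  let ?N = "matrix_inv M"
  let ?O = "oseledets_at D (graph_map \<phi>) L"
  have dM: "det M > 0" by (rule GL2_plus_det[OF D M])
  then have MN: "M ** ?N = mat 1" "?N ** M = mat 1"
    by (simp_all add: matrix_inv_inverse)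
  then have dMN: "det M * det ?N = 1" by (metis det_I det_mul)
  with dM have dN: "det ?N > 0" by (metis zero_less_mult_pos zero_less_one)
  have im: "Im (\<phi> z) \<noteq> 0" if "Im z > 0" for z
    using \<phi> that by (auto simp: upper_half_plane_def lower_half_plane_def image_subset_iff)
  \<comment> \<open>Over the geodesic of g, the twisted lift is the image under M and its conjugate
    of the graph over the geodesic of \<open>matrix_inv M ** g\<close>.\<close>
  have untwist: "oseledets_at D (twisted_map D \<phi> M) L g \<longleftrightarrow> ?O (?N ** g)" if g: "det g > 0" for g
  proof (rule oseledets_at_translate[OF D M])
    fix t
    let ?z = "mobius (?N ** g ** geodesic t) \<i>"
    have pos: "Im ?z > 0" using dN g by (intro Im_mobius_geodesic) (simp add: det_mul)
    then show "Im (fst (graph_map \<phi> ?z)) \<noteq> 0" "Im (snd (graph_map \<phi> ?z)) \<noteq> 0"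
      using im by (auto simp: graph_map_def)
    have "?z = mobius ?N (mobius (g ** geodesic t) \<i>)"
      using g dN by (intro mobius_geodesic_mult) auto
    then show "twisted_map D \<phi> M (mobius (g ** geodesic t) \<i>) =
        map_prod (mobius M) (mobius (galois_mat D M)) (graph_map \<phi> ?z)"
      by (simp add: twisted_map_def graph_map_def Let_def)
  qed
  have invariant: "?O (B ** h) \<longleftrightarrow> ?O h"
    if B: "B \<in> GL2_plus D" "commutes_with_graph D \<phi> B" and h: "det h > 0" for B h
  proof (rule oseledets_at_translate[OF D B(1)])
    fix t
    let ?z = "mobius (h ** geodesic t) \<i>"
    have pos: "Im ?z > 0" using h by (rule Im_mobius_geodesic)
    then show "Im (fst (graph_map \<phi> ?z)) \<noteq> 0" "Im (snd (graph_map \<phi> ?z)) \<noteq> 0"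
      using im by (auto simp: graph_map_def)
    have "mobius (B ** h ** geodesic t) \<i> = mobius B ?z"
      using h GL2_plus_det[OF D B(1)] by (intro mobius_geodesic_mult) auto
    then show "graph_map \<phi> (mobius (B ** h ** geodesic t) \<i>) =
        map_prod (mobius B) (mobius (galois_mat D B)) (graph_map \<phi> ?z)"
      using B(2) pos by (simp add: graph_map_def commutes_with_graph_def upper_half_plane_def)
  qed
  have orbit: "(\<forall>g'\<in>unit_tangent_point (twisted_group D \<phi> M) g.
        oseledets_at D (twisted_map D \<phi> M) L g') \<longleftrightarrow> ?O (?N ** g)" if g: "det g = 1" for g
  proof -
    have "oseledets_at D (twisted_map D \<phi> M) L (A ** g) \<longleftrightarrow> ?O (?N ** g)"
      if A: "A \<in> twisted_group D \<phi> M" for A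
    proof -
      have A': "A \<in> SL2_order D" "commutes_with_graph D \<phi> (?N ** A ** M)"
        using A by (auto simp: twisted_group_def)
      have "oseledets_at D (twisted_map D \<phi> M) L (A ** g) \<longleftrightarrow> ?O (?N ** (A ** g))"
        using A' g by (intro untwist) (simp add: det_mul SL2_order_def)
      \<comment> \<open>Inserting the identity exhibits the conjugate of A by M, which commutes with
        the graph by the definition of the twisted group.\<close>
      also have "?N ** (A ** g) = ?N ** A ** (M ** ?N) ** g"
        unfolding MN by (simp add: matrix_mul_assoc)
      also have "\<dots> = (?N ** A ** M) ** (?N ** g)" by (simp only: matrix_mul_assoc)
      also have "?O \<dots> \<longleftrightarrow> ?O (?N ** g)"
        using A' g dN by (intro invariant GL2_plus_conjugate[OF D M]) (auto simp: det_mul)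
      finally show ?thesis .
    qed
    \<comment> \<open>All points of the orbit give the same condition; the orbit must also be
      non-empty for the quantifier over it to imply that condition.\<close>
    moreover have "mat 1 \<in> twisted_group D \<phi> M"
    proof -
      have "(0::real) \<in> quad_order D" "(1::real) \<in> quad_order D"
        unfolding quad_order_def by (intro CollectI exI[of _ 0] exI[of _ 1]; force)+
      then show ?thesis
        by (auto simp: twisted_group_def SL2_order_def MN commutes_with_graph_def
            galois_mat_1[OF D] mobius_mat_1) (auto simp: mat_def)
    qed
    ultimately show ?thesis unfolding unit_tangent_point_def by blast
  qed
  have "lyapunov_exponents D (twisted_group D \<phi> M) (twisted_map D \<phi> M) L \<longleftrightarrow>
      (AE g in haar_SL2. \<forall>g'\<in>unit_tangent_point (twisted_group D \<phi> M) g.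
        oseledets_at D (twisted_map D \<phi> M) L g')"
    unfolding lyapunov_exponents_def almost_every_unit_tangent_def oseledets_at_def ..
  also have "\<dots> \<longleftrightarrow> (AE g in haar_SL2. ?O (?N ** g))"
    using AE_haar_SL2_det by (intro eventually_cong) (auto simp: orbit)
  \<comment> \<open>The factor \<open>sqrt (det M)\<close> brings \<open>matrix_inv M\<close> to
    determinant one, so that translation by it preserves null sets.\<close>
  also have "\<dots> \<longleftrightarrow> (AE g in haar_SL2. ?O ((sqrt (det M) *\<^sub>R ?N) ** g))"
    using dM by (simp add: oseledets_at_scaleR scalar_matrix_assoc[symmetric])
  also have "\<dots> \<longleftrightarrow> (AE g in haar_SL2. ?O g)"
  proof (rule AE_haar_SL2_translate_iff)
    show "det (sqrt (det M) *\<^sub>R ?N) = 1" using dM dMN by (simp add: det_scaleR_2)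
  qed
  finally show ?thesis .
qed

theorem corollary9p8:
  fixes D :: int and \<Gamma> :: "(real^2^2) set" and \<phi> :: "complex \<Rightarrow> complex" and M :: "real^2^2"
  assumes "D > 0" and "\<nexists>n::int. D = n\<^sup>2" and "D mod 4 = 0 \<or> D mod 4 = 1"
    and "\<Gamma> \<in> veech_groups_of_disc D"
    and "teichmueller_graph D \<Gamma> \<phi>"
    and "M \<in> GL2_plus D"
  shows "\<forall>L. lyapunov_exponents D (twisted_group D \<phi> M) (twisted_map D \<phi> M) L
             \<longleftrightarrow> lyapunov_exponents D \<Gamma> (graph_map \<phi>) L"
proof -
  note D = assms(1,2)
  have \<phi>: "\<phi> ` upper_half_plane \<subseteq> lower_half_plane"
    and \<Gamma>: "\<Gamma> = {A \<in> SL2_order D. commutes_with_graph D \<phi> A}"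
    using assms(5) by (auto simp: teichmueller_graph_def)
  have inv1: "matrix_inv (mat 1) = (mat 1 :: real^2^2)"
    by (rule matrix_inv_eqI) simp_all
  \<comment> \<open>The original curve is the twist by the identity matrix.\<close>
  have "twisted_group D \<phi> (mat 1) = \<Gamma>"
    by (simp add: twisted_group_def \<Gamma> inv1)
  moreover have "twisted_map D \<phi> (mat 1) = graph_map \<phi>"
    by (simp add: fun_eq_iff twisted_map_def graph_map_def inv1 mobius_mat_1 galois_mat_1[OF D])
  ultimately show ?thesis
    using lyapunov_exponents_twisted[OF D assms(6) \<phi>]
      lyapunov_exponents_twisted[OF D mat_1_GL2_plus[OF D] \<phi>] by simp
qed

end
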